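(* Let $m,n\ge 2$ be integers and let $\mathcal{A}$ be an $m$th-order $n$-dimensional strong Hankel tensor. If the order $m$ is even, then $\mathcal{A}$ is a completely decomposable tensor and a limit point of complete Hankel tensors (i.e. $\mathcal{A}$ is the limit of a sequence of complete Hankel tensors of order $m$ and dimension $n$). If the order $m$ is odd, then $\mathcal{A}$ is a completely $r$-decomposable tensor with $r=(n-1)m+1$.
   Context: Write $[n]=\{1,\dots,n\}$. $\mathrm{S}_{m,n}$ is the finite-dimensional real vector space (with its usual topology) of real symmetric tensors $\mathcal{A}=(a_{i_1\cdots i_m})$, $i_j\in[n]$, of order $m$ and dimension $n$. For $\mathbf{x}\in\mathbb{R}^n$, $\mathbf{x}^{\otimes m}\in \mathrm{S}_{m,n}$ is the tensor with entries $x_{i_1}\cdots x_{i_m}$. Hankel tensor: $\mathcal{A}\in \mathrm{S}_{m,n}$ is a Hankel tensor with generating vector $\mathbf{v}=(v_0,\dots,v_{(n-1)m})^\top$ if $a_{i_1\cdots i_m}=v_{i_1+\cdots+i_m-m}$ for all $i_1,\dots,i_m\in[n]$. Associated Hankel matrix: an $\ell\times \ell$ matrix $A=(a_{ij})$ with $\ell=\lceil ((n-1)m+2)/2\rceil$ and $a_{ij}=v_{i+j-2}$, where, if $(n-1)m$ is odd, $v_{2\lceil (n-1)m/2\rceil}=v_{(n-1)m+1}$ is an additional, freely chosen real number (so when $(n-1)m$ is even the associated matrix is unique). Strong Hankel tensor: a Hankel tensor for which there exists an associated Hankel matrix that is positive semi-definite. Complete Hankel tensor: a tensor of the form $\mathcal{A}=\sum_{i=1}^r\alpha_i\,\mathbf{u}_i^{\otimes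 m}$ for some $r$, with all $\alpha_i\ge 0$ and each $\mathbf{u}_i=(1,\gamma_i,\gamma_i^2,\dots,\gamma_i^{n-1})^\top$ for some $\gamma_i\in\mathbb{R}$. Completely $r$-decomposable tensor: $\mathcal{A}\in\mathrm{S}_{m,n}$ such that $\mathcal{A}=\sum_{j=1}^r\mathbf{x}_j^{\otimes m}$ for some $\mathbf{x}_1,\dots,\mathbf{x}_r\in\mathbb{R}^n$. $\mathcal{A}$ is completely decomposable if it is completely $r$-decomposable for some $r$. *)

theory Defs
  imports
    "HOL-Library.Multiset"
    "HOL-Analysis.Function_Topology"
    "Jordan_Normal_Form.Matrix"
begin

(* Indices start at 0, as in Jordan_Normal_Form: a multi-index is a list of length m with entries
   in {..<n}, so the subscript i_1 + ... + i_m - m of v becomes the plain sum of the list. *)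

definition multi_indices :: "nat \<Rightarrow> nat \<Rightarrow> nat list set" where
  "multi_indices m n = {is. length is = m \<and> set is \<subseteq> {..<n}}"

(* A tensor is a function on multi-indices that vanishes elsewhere; equality of tensors is thus
   equality of functions. On this finite-dimensional subspace of nat list => real, the product
   topology of the function space restricts to the usual topology. *)

definition sym_tensors :: "nat \<Rightarrow> nat \<Rightarrow> (nat list \<Rightarrow> real) set" where
  "sym_tensors m n = {A. (\<forall>is. is \<notin> multi_indices m n \<longrightarrow> A is = 0) \<and>
     (\<forall>is\<in>multi_indices m n. \<forall>js\<in>multi_indices m n. mset is = mset js \<longrightarrow> A is = A js)}"

definition tensor_power :: "nat \<Rightarrow> real vec \<Rightarrow> nat list \<Rightarrow> real" where
  "tensor_power m x = (\<lambda>is. if is \<in> multi_indices m (dim_vec x) then (\<Prod>i\<leftarrow>is. x $ i) else 0)"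

definition hankel_tensor_of :: "nat \<Rightarrow> nat \<Rightarrow> real vec \<Rightarrow> (nat list \<Rightarrow> real) \<Rightarrow> bool" where
  "hankel_tensor_of m n v A \<longleftrightarrow> A \<in> sym_tensors m n \<and> v \<in> carrier_vec ((n - 1) * m + 1) \<and>
     (\<forall>is\<in>multi_indices m n. A is = v $ sum_list is)"

(* The number c is the free entry v_{(n-1)m+1}. It occurs, in the lower right corner only, exactly
   when (n-1)m is odd. *)

definition associated_hankel_matrix :: "nat \<Rightarrow> nat \<Rightarrow> real vec \<Rightarrow> real mat \<Rightarrow> bool" where
  "associated_hankel_matrix m n v H \<longleftrightarrow>
     (let N = (n - 1) * m; l = nat \<lceil>real (N + 2) / 2\<rceil>
      in \<exists>c. H = mat l l (\<lambda>(i, j). if i + j \<le> N then v $ (i + j) else c))"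

definition pos_semidef :: "real mat \<Rightarrow> bool" where
  "pos_semidef H \<longleftrightarrow> square_mat H \<and> H\<^sup>T = H \<and> (\<forall>x\<in>carrier_vec (dim_row H). 0 \<le> x \<bullet> (H *\<^sub>v x))"

definition strong_hankel_tensor :: "nat \<Rightarrow> nat \<Rightarrow> (nat list \<Rightarrow> real) \<Rightarrow> bool" where
  "strong_hankel_tensor m n A \<longleftrightarrow>
     (\<exists>v H. hankel_tensor_of m n v A \<and> associated_hankel_matrix m n v H \<and> pos_semidef H)"

definition vandermonde_vec :: "nat \<Rightarrow> real \<Rightarrow> real vec" where
  "vandermonde_vec n \<gamma> = vec n (\<lambda>k. \<gamma> ^ k)"

definition complete_hankel_tensor :: "nat \<Rightarrow> nat \<Rightarrow> (nat list \<Rightarrow> real) \<Rightarrow> bool" where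
  "complete_hankel_tensor m n A \<longleftrightarrow>
     (\<exists>(r::nat) \<alpha> \<gamma>. (\<forall>i<r. 0 \<le> \<alpha> i) \<and>
        A = (\<lambda>is. \<Sum>i<r. \<alpha> i * tensor_power m (vandermonde_vec n (\<gamma> i)) is))"

definition completely_r_decomposable :: "nat \<Rightarrow> nat \<Rightarrow> nat \<Rightarrow> (nat list \<Rightarrow> real) \<Rightarrow> bool" where
  "completely_r_decomposable m n r A \<longleftrightarrow> A \<in> sym_tensors m n \<and>
     (\<exists>x. (\<forall>j<r. x j \<in> carrier_vec n) \<and> A = (\<lambda>is. \<Sum>j<r. tensor_power m (x j) is))"

definition completely_decomposable :: "nat \<Rightarrow> nat \<Rightarrow> (nat list \<Rightarrow> real) \<Rightarrow> bool" where
  "completely_decomposable m n A \<longleftrightarrow> (\<exists>r. completely_r_decomposable m n r A)"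

end

theory Submission
  imports Defs "HOL-Computational_Algebra.Fundamental_Theorem_Algebra"
begin

text \<open>
  The entry of a Hankel tensor at a multi-index depends only on the sum \<open>k\<close> of that index, and so
  does the entry of \<open>c \<cdot> u\<^sup>m\<close> for a Vandermonde vector \<open>u = (1, \<gamma>, \<gamma>\<^sup>2, \<dots>)\<close>, where it is
  \<open>c\<^sup>m \<gamma>\<^sup>k\<close>. Decomposing the tensor thus means representing the numbers \<open>v\<^sub>0, \<dots>, v\<^sub>N\<close>,
  \<open>N = (n - 1) m\<close>, as power moments \<open>v\<^sub>k = \<Sum> \<alpha>\<^sub>x x\<^sup>k\<close> of finitely many weighted real nodes, with
  weights that have real \<open>m\<close>-th roots.

  If \<open>m\<close> is odd, every real number has an \<open>m\<close>-th root, so weights of either sign are fine, and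
  Lagrange interpolation at any \<open>N + 1\<close> nodes provides them (\<open>moments_signed_representation\<close>).

  If \<open>m\<close> is even, then \<open>N = 2 D\<close> and nonnegative weights are wanted: this is the truncated
  Hamburger moment problem, solved in \<open>truncated_hamburger_moments\<close>. Semidefiniteness of the Hankel
  matrix says that the linear functional \<open>\<Lambda>\<close> with \<open>\<Lambda>(X\<^sup>k) = v\<^sub>k\<close> is nonnegative on squares of
  polynomials of degree at most \<open>D\<close>. There is a monic polynomial \<open>p\<close> of degree \<open>d \<le> D\<close> such that
  \<open>\<Lambda>(p q) = 0\<close> whenever \<open>p q\<close> has degree less than \<open>2 D\<close>, and such that \<open>\<Lambda>\<close> is strictly positive
  on nonzero squares of polynomials of degree less than \<open>d\<close> (\<open>exists_orthogonal_polynomial\<close>). A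
  factor \<open>(X - a)\<^sup>2 + b\<^sup>2\<close> of \<open>p\<close> would contradict this strict positivity, so \<open>p\<close> has \<open>d\<close> distinct
  real roots (\<open>orthogonal_polynomial_split\<close>). They are the nodes of a Gauss quadrature that
  computes \<open>\<Lambda>\<close> in degrees below \<open>2 D\<close>. In degree \<open>2 D\<close> itself a defect \<open>w \<ge> 0\<close> may remain.

  The defect is the tensor \<open>w \<cdot> e\<^sup>m\<close> for the last unit vector \<open>e\<close>, again an \<open>m\<close>-th power, hence
  complete decomposability. It is also the limit of \<open>(w / t\<^sup>N) \<cdot> u(t)\<^sup>m\<close> for the Vandermonde
  vectors \<open>u(t)\<close> of nodes \<open>t \<rightarrow> \<infinity>\<close>, which gives the approximation by complete Hankel tensors.
\<close>

section \<open>The Riesz functional of a sequence\<close>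

text \<open>The linear functional on polynomials that sends \<open>X\<^sup>k\<close> to \<open>s k\<close>.\<close>

definition riesz :: "(nat \<Rightarrow> real) \<Rightarrow> real poly \<Rightarrow> real" where
  "riesz s f = (\<Sum>k\<le>degree f. coeff f k * s k)"

lemma riesz_eq_sum:
  assumes "degree f \<le> N"
  shows "riesz s f = (\<Sum>k\<le>N. coeff f k * s k)"
  unfolding riesz_def
  by (rule sum.mono_neutral_left) (use assms in \<open>auto simp: coeff_eq_0\<close>)

lemma riesz_0 [simp]: "riesz s 0 = 0"
  by (simp add: riesz_def)

lemma riesz_add: "riesz s (f + g) = riesz s f + riesz s g"
proof -
  define N where "N = max (degree f) (degree g)"
  have "degree (f + g) \<le> N" "degree f \<le> N" "degree g \<le> N"
    by (auto simp: N_def intro: degree_add_le)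
  then show ?thesis
    by (simp add: riesz_eq_sum[where N = N] sum.distrib algebra_simps)
qed

lemma riesz_smult: "riesz s (smult c f) = c * riesz s f"
proof -
  have "degree (smult c f) \<le> degree f" by (rule degree_smult_le)
  then show ?thesis
    by (simp add: riesz_eq_sum[where N = "degree f"] sum_distrib_left algebra_simps)
qed

lemma riesz_diff: "riesz s (f - g) = riesz s f - riesz s g"
  using riesz_add[of s "f - g" g] by simp

lemma riesz_sum: "riesz s (\<Sum>i\<in>I. f i) = (\<Sum>i\<in>I. riesz s (f i))"
  by (induction I rule: infinite_finite_induct) (simp_all add: riesz_add)

lemma riesz_monom: "riesz s (monom c k) = c * s k"
proof -
  have "riesz s (monom c k) = (\<Sum>i\<le>k. coeff (monom c k) i * s i)"
    by (rule riesz_eq_sum) (rule degree_monom_le)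
  also have "\<dots> = (\<Sum>i\<in>{k}. coeff (monom c k) i * s i)"
    by (rule sum.mono_neutral_right) auto
  finally show ?thesis by simp
qed

text \<open>The quadratic form of the Hankel matrix of \<open>s\<close>: this links semidefiniteness of the matrix to
  nonnegativity of the functional on squares.\<close>

lemma riesz_square:
  assumes "degree f \<le> D"
  shows "riesz s (f * f) = (\<Sum>i\<le>D. \<Sum>j\<le>D. coeff f i * coeff f j * s (i + j))"
proof -
  have f: "f = (\<Sum>i\<le>D. monom (coeff f i) i)"
    using poly_as_sum_of_monoms'[OF assms] by simp
  have "f * f = (\<Sum>i\<le>D. \<Sum>j\<le>D. monom (coeff f i * coeff f j) (i + j))"
    by (subst (1 2) f) (simp add: sum_product mult_monom)
  then show ?thesis by (simp add: riesz_sum riesz_monom)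
qed

section \<open>Orthogonal polynomials of a positive semidefinite functional\<close>

lemma linear_nonneg_imp_0:
  fixes a b :: real
  assumes "\<And>t. 0 \<le> a * t + b"
  shows "a = 0"
proof (rule ccontr)
  assume "a \<noteq> 0"
  then have "a * (- (b + 1) / a) + b < 0" by simp
  with assms[of "- (b + 1) / a"] show False by linarith
qed

text \<open>The equality case of the Cauchy-Schwarz inequality: a vector on which a semidefinite form
  vanishes is in the radical, because \<open>\<Lambda>((t p + q)\<^sup>2)\<close> is affine in \<open>t\<close> and nonnegative.\<close>

lemma riesz_kernel_orthogonal:
  assumes pos: "\<And>f. degree f \<le> D \<Longrightarrow> 0 \<le> riesz s (f * f)"
    and p: "degree p \<le> D" "riesz s (p * p) = 0"
    and q: "degree q \<le> D"
  shows "riesz s (p * q) = 0"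
proof -
  have "0 \<le> (2 * riesz s (p * q)) * t + riesz s (q * q)" for t
  proof -
    let ?f = "smult t p + q"
    have "degree ?f \<le> D"
      using p(1) q by (auto intro!: degree_add_le order_trans[OF degree_smult_le])
    then have "0 \<le> riesz s (?f * ?f)" by (rule pos)
    also have "?f * ?f = smult (t * t) (p * p) + smult (2 * t) (p * q) + q * q"
    proof -
      have "smult (2 * t) (p * q) = smult t (p * q) + smult t (p * q)"
        by (simp flip: smult_add_left)
      then show ?thesis by (simp add: algebra_simps)
    qed
    also have "riesz s \<dots> = 2 * t * riesz s (p * q) + riesz s (q * q)"
      by (simp add: riesz_add riesz_smult p(2))
    finally show ?thesis by (simp add: algebra_simps)
  qed
  from linear_nonneg_imp_0[OF this] show ?thesis by simp
qed

lemma degree_monom_1_mult: "degree (monom (1::real) j * p) \<le> j + degree p"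
  using degree_mult_le[of "monom (1::real) j" p] by (simp add: degree_monom_eq)

text \<open>The degree of \<open>q\<close> may exceed \<open>D\<close> here. The reason is that multiplication by \<open>X\<close> preserves the
  radical: \<open>\<Lambda>((X h)\<^sup>2) = \<Lambda>(h \<cdot> X\<^sup>2 h) = 0\<close> as long as \<open>X\<^sup>2 h\<close> still has degree at most \<open>D\<close>. So all
  \<open>X\<^sup>j p\<close> of degree less than \<open>D\<close> are in the radical, and pairing these with \<open>X\<^sup>i\<close>, \<open>i \<le> D\<close>,
  reaches every product of degree less than \<open>2 D\<close>.\<close>

lemma riesz_kernel_shift:
  assumes pos: "\<And>f. degree f \<le> D \<Longrightarrow> 0 \<le> riesz s (f * f)"
    and p: "degree p < D" "riesz s (p * p) = 0"
    and q: "degree p + degree q < 2 * D"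
  shows "riesz s (p * q) = 0"
proof -
  have kernel: "riesz s ((monom 1 j * p) * (monom 1 j * p)) = 0" if "degree p + j < D" for j
    using that
  proof (induction j)
    case 0
    then show ?case using p(2) by (simp add: monom_0)
  next
    case (Suc j)
    let ?h = "monom 1 j * p"
    have "riesz s (?h * (monom 1 2 * ?h)) = 0"
    proof (rule riesz_kernel_orthogonal[OF pos])
      show "degree ?h \<le> D" using degree_monom_1_mult[of j p] Suc.prems by simp
      show "degree (monom 1 2 * ?h) \<le> D"
        using degree_monom_1_mult[of j p] degree_monom_1_mult[of 2 ?h] Suc.prems by simp
    qed (use Suc in auto)
    moreover have "?h * (monom 1 2 * ?h) = (monom 1 (Suc j) * p) * (monom 1 (Suc j) * p)"
    proof -
      have "(monom 1 (Suc j) :: real poly) = monom 1 1 * monom 1 j"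
        "(monom 1 2 :: real poly) = monom 1 1 * monom 1 1"
        by (simp_all add: mult_monom numeral_2_eq_2)
      then show ?thesis by (simp only: ac_simps)
    qed
    ultimately show ?case by simp
  qed
  have monomial: "riesz s (p * monom 1 k) = 0" if "degree p + k < 2 * D" for k
  proof -
    \<comment> \<open>Put as much of \<open>X\<^sup>k\<close> on the side of \<open>p\<close> as keeps that side of degree less than \<open>D\<close>.\<close>
    define j where "j = min k (D - 1 - degree p)"
    have j: "degree p + j < D" "k - j \<le> D" "j \<le> k"
      using p(1) that by (auto simp: j_def)
    have "riesz s ((monom 1 j * p) * monom 1 (k - j)) = 0"
    proof (rule riesz_kernel_orthogonal[OF pos])
      show "degree (monom 1 j * p) \<le> D" using degree_monom_1_mult[of j p] j(1) by simp
      show "degree (monom (1::real) (k - j)) \<le> D" using j(2) by (simp add: degree_monom_eq)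
    qed (use kernel j in auto)
    moreover have "(monom 1 j * p) * monom 1 (k - j) = p * monom 1 k"
    proof -
      have "(monom 1 j * p) * monom 1 (k - j) = p * (monom 1 j * monom 1 (k - j))"
        by (simp only: ac_simps)
      then show ?thesis using j(3) by (simp add: mult_monom)
    qed
    ultimately show ?thesis by simp
  qed
  have "p * q = p * (\<Sum>k\<le>degree q. monom (coeff q k) k)"
    by (simp add: poly_as_sum_of_monoms)
  also have "\<dots> = (\<Sum>k\<le>degree q. smult (coeff q k) (p * monom 1 k))"
    by (simp add: sum_distrib_left smult_monom flip: mult_smult_right)
  also have "riesz s \<dots> = 0"
    unfolding riesz_sum riesz_smult
    by (rule sum.neutral) (use q monomial in auto)
  finally show ?thesis .
qed

lemma degree_less_if_coeffs_0:
  fixes q :: "'a::zero poly"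
  assumes "q \<noteq> 0" "\<forall>k\<ge>e. coeff q k = 0"
  shows "degree q < e"
  using assms leading_coeff_0_iff[of q] by (metis not_le)

text \<open>Orthogonal projection onto the polynomials of degree less than \<open>e\<close>, built as in the
  Gram-Schmidt process by adding one monic orthogonal polynomial of degree \<open>e\<close> at a time. The degree
  bound is written with coefficients so that the zero polynomial also satisfies it when \<open>e = 0\<close>.\<close>

lemma riesz_projection:
  assumes pos: "\<And>f. f \<noteq> 0 \<Longrightarrow> degree f < e \<Longrightarrow> 0 < riesz s (f * f)"
  shows "\<exists>r. (\<forall>k\<ge>e. coeff r k = 0) \<and>
    (\<forall>q. (\<forall>k\<ge>e. coeff q k = 0) \<longrightarrow> riesz s ((f - r) * q) = 0)"
  using pos
proof (induction e arbitrary: f)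
  case 0
  show ?case
  proof (intro exI[of _ 0] conjI allI impI)
    fix q :: "real poly"
    assume "\<forall>k\<ge>0. coeff q k = 0"
    then have "q = 0" by (simp add: poly_eq_iff)
    then show "riesz s ((f - 0) * q) = 0" by simp
  qed simp
next
  case (Suc e)
  have IH: "\<exists>r. (\<forall>k\<ge>e. coeff r k = 0) \<and>
    (\<forall>q. (\<forall>k\<ge>e. coeff q k = 0) \<longrightarrow> riesz s ((f - r) * q) = 0)" for f
    by (rule Suc.IH) (use Suc.prems in auto)
  obtain r1 where r1: "\<forall>k\<ge>e. coeff r1 k = 0"
    "\<And>q. \<forall>k\<ge>e. coeff q k = 0 \<Longrightarrow> riesz s ((monom 1 e - r1) * q) = 0"
    using IH[of "monom 1 e"] by blast
  obtain r0 where r0: "\<forall>k\<ge>e. coeff r0 k = 0"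
    "\<And>q. \<forall>k\<ge>e. coeff q k = 0 \<Longrightarrow> riesz s ((f - r0) * q) = 0"
    using IH[of f] by blast
  define p where "p = monom 1 e - r1"
  have p_e: "coeff p e = 1" and p_gt: "\<forall>k>e. coeff p k = 0"
    using r1(1) by (auto simp: p_def)
  then have "p \<noteq> 0" "degree p < Suc e" by (auto intro: degree_lessI)
  then have pp: "0 < riesz s (p * p)" by (rule Suc.prems)
  define c where "c = riesz s (f * p) / riesz s (p * p)"
  have ortho: "riesz s ((f - (r0 + smult c p)) * q) = 0" if q: "\<forall>k\<ge>Suc e. coeff q k = 0" for q
  proof -
    define q' where "q' = q - smult (coeff q e) p"
    have q': "\<forall>k\<ge>e. coeff q' k = 0"
    proof (intro allI impI)
      fix k assume "e \<le> k"
      then consider "k = e" | "Suc e \<le> k" by linarith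
      then show "coeff q' k = 0" using q p_e p_gt by cases (auto simp: q'_def)
    qed
    have q_eq: "q = smult (coeff q e) p + q'" by (simp add: q'_def)
    have p_orth: "riesz s (p * g) = 0" if "\<forall>k\<ge>e. coeff g k = 0" for g
      using r1(2)[OF that] by (simp add: p_def)
    have *: "riesz s ((f - (r0 + smult c p)) * g)
        = riesz s ((f - r0) * g) - c * riesz s (p * g)" for g
      by (simp add: diff_diff_eq[symmetric] left_diff_distrib[of "f - r0"] riesz_diff riesz_smult)
    have "riesz s ((f - (r0 + smult c p)) * q') = 0"
      unfolding * using r0(2)[OF q'] p_orth[OF q'] by simp
    moreover have "riesz s ((f - r0) * p) = riesz s (f * p)"
      using p_orth[OF r0(1)] by (simp add: left_diff_distrib riesz_diff mult.commute[of r0])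
    then have "riesz s ((f - (r0 + smult c p)) * p) = 0"
      unfolding * using pp by (simp add: c_def)
    ultimately show ?thesis
      by (subst q_eq) (simp only: distrib_left mult_smult_right riesz_add riesz_smult)
  qed
  show ?case
    by (rule exI[of _ "r0 + smult c p"]) (use ortho r0(1) p_gt in auto)
qed

text \<open>If \<open>\<Lambda>\<close> vanishes on the square of some nonzero polynomial of degree less than \<open>D\<close>, such a
  polynomial of least degree serves, by the shift argument. Otherwise \<open>\<Lambda>\<close> is positive definite below
  degree \<open>D\<close>, and the orthogonal polynomial of degree \<open>D\<close> serves. The two cases share the
  orthogonality range \<open>degree (p * q) < 2 * D\<close>, so the sequel need not distinguish them.\<close>

lemma exists_orthogonal_polynomial:
  assumes pos: "\<And>f. degree f \<le> D \<Longrightarrow> 0 \<le> riesz s (f * f)"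
  obtains p where "lead_coeff p = 1" "degree p \<le> D"
    "\<And>q. degree p + degree q < 2 * D \<Longrightarrow> riesz s (p * q) = 0"
    "\<And>f. f \<noteq> 0 \<Longrightarrow> degree f < degree p \<Longrightarrow> 0 < riesz s (f * f)"
proof (cases "\<exists>f. f \<noteq> 0 \<and> degree f < D \<and> riesz s (f * f) = 0")
  case True
  let ?K = "\<lambda>f. f \<noteq> 0 \<and> degree f < D \<and> riesz s (f * f) = 0"
  from True obtain f0 where "?K f0" by blast
  then obtain f where f: "f \<noteq> 0" "degree f < D" "riesz s (f * f) = 0"
    and min: "\<And>g. ?K g \<Longrightarrow> degree f \<le> degree g"
    using ex_has_least_nat[of ?K f0 degree] by blast
  define p where "p = smult (inverse (lead_coeff f)) f"
  have deg: "degree p = degree f" using f(1) by (simp add: p_def)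
  have "lead_coeff p = 1" using f(1) by (simp add: p_def)
  moreover have "riesz s (p * p) = 0" using f(3) by (simp add: p_def riesz_smult)
  then have "riesz s (p * q) = 0" if "degree p + degree q < 2 * D" for q
    using riesz_kernel_shift[OF pos, of D p q] f(2) deg that by simp
  moreover have "0 < riesz s (g * g)" if "g \<noteq> 0" "degree g < degree p" for g
  proof -
    have "riesz s (g * g) \<noteq> 0" using min[of g] that f(2) deg by auto
    moreover have "0 \<le> riesz s (g * g)" by (rule pos) (use that f(2) deg in simp)
    ultimately show ?thesis by simp
  qed
  ultimately show ?thesis using that[of p] f(2) deg by simp
next
  case False
  then have pos': "0 < riesz s (f * f)" if "f \<noteq> 0" "degree f < D" for f
    using pos[of f] that by (auto simp: less_le)
  obtain r where r: "\<forall>k\<ge>D. coeff r k = 0"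
    and orth: "\<And>q. \<forall>k\<ge>D. coeff q k = 0 \<Longrightarrow> riesz s ((monom 1 D - r) * q) = 0"
    using riesz_projection[where f = "monom 1 D", OF pos'] by blast
  define p where "p = monom 1 D - r"
  have "coeff p D = 1" "\<forall>k>D. coeff p k = 0" using r by (auto simp: p_def)
  then have deg: "degree p = D"
    by (intro antisym degree_le le_degree) auto
  show ?thesis
  proof (rule that[of p])
    show "lead_coeff p = 1" using \<open>coeff p D = 1\<close> deg by simp
    show "riesz s (p * q) = 0" if "degree p + degree q < 2 * D" for q
      unfolding p_def by (rule orth) (use that deg in \<open>auto simp: coeff_eq_0\<close>)
  qed (use deg pos' in auto)
qed

section \<open>Real polynomials with simple real roots\<close>

text \<open>A complex root \<open>a + i b\<close>, which exists by the fundamental theorem of algebra, is not real. The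
  remainder of \<open>p\<close> modulo \<open>(X - a)\<^sup>2 + b\<^sup>2\<close> is a real polynomial of degree at most one with this
  root, hence zero.\<close>

lemma real_poly_conjugate_factor:
  fixes p :: "real poly"
  assumes "0 < degree p" and no_root: "\<And>x. poly p x \<noteq> 0"
  shows "\<exists>a b. [:a\<^sup>2 + b\<^sup>2, - 2 * a, 1:] dvd p"
proof -
  define ev where "ev f z = poly (map_poly complex_of_real f) z" for f z
  have ev_pCons: "ev (pCons c f) z = of_real c + z * ev f z" for c f z
    by (simp add: ev_def map_poly_pCons)
  have ev_0: "ev 0 z = 0" for z by (simp add: ev_def)
  have ev_add: "ev (f + g) z = ev f z + ev g z" for f g z
    by (induction f g rule: poly_induct2) (simp_all add: ev_0 ev_pCons algebra_simps)
  have ev_smult: "ev (smult c f) z = of_real c * ev f z" for c f z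
    by (induction f) (simp_all add: ev_0 ev_pCons algebra_simps)
  have ev_mult: "ev (f * g) z = ev f z * ev g z" for f g z
    by (induction f) (simp_all add: ev_0 ev_pCons ev_add ev_smult algebra_simps)
  have ev_real: "ev f (of_real x) = of_real (poly f x)" for f x
    by (induction f) (simp_all add: ev_0 ev_pCons)
  have "degree (map_poly complex_of_real p) = degree p"
    by (rule degree_map_poly) auto
  then have "\<not> constant (poly (map_poly complex_of_real p))"
    using assms(1) by (simp add: constant_degree)
  then obtain z where z: "ev p z = 0"
    using fundamental_theorem_of_algebra unfolding ev_def by blast
  define a b where "a = Re z" and "b = Im z"
  have z_eq: "z = Complex a b" by (simp add: a_def b_def)
  have "b \<noteq> 0"
  proof
    assume "b = 0"
    then have "z = of_real a" by (simp add: z_eq complex_eq_iff)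
    with z no_root[of a] show False by (simp add: ev_real)
  qed
  define h where "h = [:a\<^sup>2 + b\<^sup>2, - 2 * a, 1:]"
  have h_z: "ev h z = 0"
    by (simp add: h_def ev_pCons ev_0 z_eq complex_eq_iff power2_eq_square algebra_simps)
  define r where "r = p mod h"
  have h_deg: "h \<noteq> 0" "degree h = 2" by (simp_all add: h_def)
  have "degree r \<le> 1" using degree_mod_less[of h p] h_deg by (auto simp: r_def)
  have "r = [:coeff r 0, coeff r 1:]"
  proof (rule poly_eqI)
    fix k
    show "coeff r k = coeff [:coeff r 0, coeff r 1:] k"
    proof (cases "k \<le> 1")
      case True
      then have "k = 0 \<or> k = 1" by auto
      then show ?thesis by auto
    next
      case False
      then show ?thesis using \<open>degree r \<le> 1\<close>
        by (auto simp: coeff_eq_0 coeff_pCons split: nat.splits)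
    qed
  qed
  moreover have "ev r z = 0"
  proof -
    have "ev p z = ev (p div h * h + r) z" by (simp add: r_def)
    then show ?thesis using z h_z by (simp only: ev_add ev_mult) simp
  qed
  ultimately have "of_real (coeff r 0) + z * of_real (coeff r 1) = 0"
    by (metis ev_pCons ev_0 add.right_neutral mult_zero_right)
  then have "coeff r 1 = 0 \<and> coeff r 0 = 0"
    using \<open>b \<noteq> 0\<close> by (auto simp: z_eq complex_eq_iff)
  with \<open>r = [:coeff r 0, coeff r 1:]\<close> have "r = 0" by simp
  then have "h dvd p" by (simp add: r_def mod_eq_0_iff_dvd)
  then show ?thesis unfolding h_def by blast
qed

lemma prod_roots_dvd:
  fixes p :: "real poly"
  assumes "finite S" "\<And>x. x \<in> S \<Longrightarrow> poly p x = 0"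
  shows "(\<Prod>x\<in>S. [:- x, 1:]) dvd p"
  using assms
proof (induction S arbitrary: p)
  case empty
  then show ?case by simp
next
  case (insert x S)
  then obtain q where q: "p = [:- x, 1:] * q"
    by (metis dvdE insertI1 poly_eq_0_iff_dvd)
  have "poly q y = 0" if "y \<in> S" for y
    using insert.prems[of y] that insert.hyps(2) by (auto simp: q)
  then have "(\<Prod>x\<in>S. [:- x, 1:]) dvd q" by (rule insert.IH)
  then show ?case using insert.hyps by (simp add: q mult_dvd_mono del: mult_pCons_left)
qed

lemma degree_prod_roots:
  "finite S \<Longrightarrow> degree (\<Prod>x\<in>S. [:- x, 1::real:]) = card S"
  by (subst degree_prod_eq_sum_degree) auto

text \<open>The forbidden factors are those of the form \<open>(X - a)\<^sup>2 + b\<^sup>2\<close>. With \<open>b = 0\<close> they are the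
  double roots, with \<open>b \<noteq> 0\<close> the pairs of conjugate roots; both obstructions are thus excluded by
  one condition.\<close>

lemma no_sum_of_squares_factor_imp_split:
  fixes p :: "real poly"
  assumes "lead_coeff p = 1"
    and none: "\<And>a b. \<not> [:a\<^sup>2 + b\<^sup>2, - 2 * a, 1:] dvd p"
  shows "p = (\<Prod>x | poly p x = 0. [:- x, 1:])"
proof -
  let ?S = "{x. poly p x = 0}"
  let ?P = "\<Prod>x\<in>?S. [:- x, 1:]"
  have "p \<noteq> 0" using assms(1) by auto
  then have fin: "finite ?S" by (rule poly_roots_finite)
  obtain q where q: "p = ?P * q" using prod_roots_dvd[OF fin, of p] by auto
  have no_root: "poly q x \<noteq> 0" for x
  proof
    assume x: "poly q x = 0"
    then have "x \<in> ?S" by (subst q) simp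
    then have "[:- x, 1:] dvd ?P" using fin by (simp add: dvd_prod_eqI)
    moreover have "[:- x, 1:] dvd q" using x by (simp add: poly_eq_0_iff_dvd)
    ultimately have "[:- x, 1:] * [:- x, 1:] dvd ?P * q" by (rule mult_dvd_mono)
    moreover have "[:- x, 1:] * [:- x, 1:] = [:x\<^sup>2 + 0\<^sup>2, - 2 * x, 1:]"
      by (simp add: power2_eq_square)
    ultimately show False using none[of x 0] q by metis
  qed
  have "degree q = 0"
  proof (rule ccontr)
    assume "degree q \<noteq> 0"
    then obtain a b where "[:a\<^sup>2 + b\<^sup>2, - 2 * a, 1:] dvd q"
      using real_poly_conjugate_factor[of q] no_root by auto
    then have "[:a\<^sup>2 + b\<^sup>2, - 2 * a, 1:] dvd p" by (subst q) (rule dvd_mult)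
    with none show False by blast
  qed
  moreover have "lead_coeff q = 1"
  proof -
    have "lead_coeff ?P = 1" by (simp add: lead_coeff_prod)
    moreover have "lead_coeff p = lead_coeff ?P * lead_coeff q" using q lead_coeff_mult by metis
    ultimately show ?thesis using assms(1) by simp
  qed
  ultimately have "q = 1" by (metis degree_0_id of_nat_1 one_pCons degree_eq_zeroE lead_coeff_pCons(2) coeff_pCons_0)
  then show ?thesis using q by simp
qed

section \<open>Lagrange interpolation and signed representations\<close>

definition lagrange_basis :: "real set \<Rightarrow> real \<Rightarrow> real poly" where
  "lagrange_basis S x = (\<Prod>y\<in>S - {x}. smult (inverse (x - y)) [:- y, 1:])"

lemma poly_lagrange_basis:
  assumes "finite S" "y \<in> S"
  shows "poly (lagrange_basis S x) y = (if y = x then 1 else 0)"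
proof (cases "y = x")
  case True
  have "poly (smult (inverse (x - z)) [:- z, 1:]) x = 1" if "z \<in> S - {x}" for z
    using that by (simp del: smult_pCons)
  then show ?thesis
    using True by (simp add: lagrange_basis_def poly_prod del: smult_pCons poly_smult)
next
  case False
  then show ?thesis
    using assms by (auto simp: lagrange_basis_def poly_prod prod_zero_iff)
qed

lemma degree_lagrange_basis:
  assumes "finite S" "x \<in> S"
  shows "degree (lagrange_basis S x) < card S"
proof -
  have "degree (lagrange_basis S x)
      \<le> (\<Sum>y\<in>S - {x}. degree (smult (inverse (x - y)) [:- y, 1:]))"
    unfolding lagrange_basis_def 
    using degree_prod_sum_le[of "S - {x}" "\<lambda>y. smult (inverse (x - y)) [:- y, 1:]"] assms(1)
    by (simp add: comp_def del: smult_pCons)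
  also have "\<dots> \<le> (\<Sum>y\<in>S - {x}. 1)"
    by (rule sum_mono) simp
  also have "\<dots> < card S"
    using assms card_gt_0_iff[of S] by (auto simp: card_Diff_singleton)
  finally show ?thesis .
qed

lemma degree_lagrange_sum:
  assumes "finite S" "S \<noteq> {}"
  shows "degree (\<Sum>x\<in>S. smult (c x) (lagrange_basis S x)) < card S"
proof -
  have "degree (\<Sum>x\<in>S. smult (c x) (lagrange_basis S x)) \<le> card S - 1"
    using assms degree_lagrange_basis[OF assms(1)]
    by (intro degree_sum_le order_trans[OF degree_smult_le]) force+
  then show ?thesis using assms card_gt_0_iff[of S] by linarith
qed

lemma lagrange_remainder_dvd:
  assumes "finite S"
  shows "(\<Prod>x\<in>S. [:- x, 1:]) dvd f - (\<Sum>x\<in>S. smult (poly f x) (lagrange_basis S x))"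
proof (rule prod_roots_dvd[OF assms])
  fix y assume "y \<in> S"
  then have "(\<Sum>x\<in>S. poly f x * poly (lagrange_basis S x) y) = (\<Sum>x\<in>S. if x = y then poly f x else 0)"
    by (intro sum.cong) (auto simp: poly_lagrange_basis[OF assms])
  then show "poly (f - (\<Sum>x\<in>S. smult (poly f x) (lagrange_basis S x))) y = 0"
    using \<open>y \<in> S\<close> assms by (simp add: poly_sum)
qed

lemma riesz_lagrange_sum:
  "riesz s (\<Sum>x\<in>S. smult (poly f x) (lagrange_basis S x))
     = (\<Sum>x\<in>S. riesz s (lagrange_basis S x) * poly f x)"
  by (simp add: riesz_sum riesz_smult mult.commute)

text \<open>Interpolation at more than \<open>k\<close> nodes reproduces \<open>X\<^sup>k\<close>, so applying \<open>\<Lambda>\<close> to the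
  interpolation formula yields the moment.\<close>

lemma moments_signed_representation:
  assumes "finite S" "k < card S"
  shows "s k = (\<Sum>x\<in>S. riesz s (lagrange_basis S x) * x ^ k)"
proof -
  let ?I = "\<Sum>x\<in>S. smult (poly (monom 1 k) x) (lagrange_basis S x)"
  have "S \<noteq> {}" using assms by auto
  have "monom 1 k = ?I"
  proof (rule ccontr)
    assume "monom 1 k \<noteq> ?I"
    then have "card S \<le> degree (monom 1 k - ?I)"
      using dvd_imp_degree_le[OF lagrange_remainder_dvd[OF assms(1), of "monom 1 k"]]
      by (simp add: degree_prod_roots[OF assms(1)])
    moreover have "degree (monom 1 k - ?I) < card S"
      using assms degree_lagrange_sum[OF assms(1) \<open>S \<noteq> {}\<close>]
      by (intro degree_diff_less) (auto simp: degree_monom_eq)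
    ultimately show False by simp
  qed
  then have "riesz s (monom 1 k) = (\<Sum>x\<in>S. riesz s (lagrange_basis S x) * poly (monom 1 k) x)"
    using riesz_lagrange_sum by metis
  then show ?thesis by (simp add: riesz_monom poly_monom)
qed

section \<open>The truncated Hamburger moment problem\<close>

text \<open>If \<open>p = ((X - a)\<^sup>2 + b\<^sup>2) q\<close>, then \<open>0 = \<Lambda>(p q) = \<Lambda>(((X - a) q)\<^sup>2) + b\<^sup>2 \<Lambda>(q\<^sup>2)\<close>, although
  \<open>(X - a) q\<close> and \<open>q\<close> are nonzero of degree less than that of \<open>p\<close>.\<close>

lemma orthogonal_polynomial_split:
  assumes "lead_coeff p = 1"
    and orth: "\<And>q. degree p + degree q < 2 * degree p \<Longrightarrow> riesz s (p * q) = 0"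
    and pos: "\<And>f. f \<noteq> 0 \<Longrightarrow> degree f < degree p \<Longrightarrow> 0 < riesz s (f * f)"
  shows "p = (\<Prod>x | poly p x = 0. [:- x, 1:])"
proof (rule no_sum_of_squares_factor_imp_split[OF assms(1)])
  fix a b
  show "\<not> [:a\<^sup>2 + b\<^sup>2, - 2 * a, 1:] dvd p"
  proof
    assume "[:a\<^sup>2 + b\<^sup>2, - 2 * a, 1:] dvd p"
    then obtain q where q: "p = [:a\<^sup>2 + b\<^sup>2, - 2 * a, 1:] * q" by (elim dvdE)
    have "q \<noteq> 0" using assms(1) q by auto
    then have deg: "degree p = 2 + degree q"
      by (subst q, subst degree_mult_eq) auto
    let ?g = "[:- a, 1:] * q"
    have g: "?g \<noteq> 0" using \<open>q \<noteq> 0\<close> by (simp del: mult_pCons_left)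
    have deg_g: "degree ?g = 1 + degree q"
      using \<open>q \<noteq> 0\<close> by (subst degree_mult_eq) auto
    have "p * q = ?g * ?g + smult (b\<^sup>2) (q * q)"
    proof -
      have "[:a\<^sup>2 + b\<^sup>2, - 2 * a, 1:] = [:- a, 1:] * [:- a, 1:] + [:b\<^sup>2:]"
        by (simp add: power2_eq_square)
      then have "p * q = ([:- a, 1:] * [:- a, 1:] + [:b\<^sup>2:]) * q * q" using q by metis
      also have "\<dots> = ?g * ?g + [:b\<^sup>2:] * (q * q)"
        by (simp only: distrib_right mult.assoc) (simp only: ac_simps)
      finally show ?thesis by simp
    qed
    then have "riesz s (p * q) = riesz s (?g * ?g) + b\<^sup>2 * riesz s (q * q)"
      by (simp only: riesz_add riesz_smult)
    moreover have "riesz s (p * q) = 0" by (rule orth) (simp add: deg)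
    moreover have "0 < riesz s (?g * ?g)" using g deg deg_g by (intro pos) linarith+
    moreover have "0 < riesz s (q * q)" using \<open>q \<noteq> 0\<close> deg by (intro pos) auto
    then have "0 \<le> b\<^sup>2 * riesz s (q * q)" by simp
    ultimately show False by linarith
  qed
qed

text \<open>Gauss quadrature at the roots of the orthogonal polynomial \<open>p\<close>. The remainder of interpolation
  at these nodes is a multiple of \<open>p\<close>, so \<open>\<Lambda>\<close> does not see it in degrees below \<open>2 D\<close>. Both
  nonnegativity claims follow by evaluating \<open>\<Lambda>\<close> on a square: that of a Lagrange basis polynomial for
  the weights, and that of a monic multiple of \<open>p\<close> of degree \<open>D\<close> for the defect \<open>w\<close>. The defect
  can be positive, as for the moments \<open>0, \<dots>, 0, 1\<close>: it is the mass of a node at infinity.\<close>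

theorem truncated_hamburger_moments:
  assumes "0 < D"
    and pos: "\<And>f. degree f \<le> D \<Longrightarrow> 0 \<le> riesz s (f * f)"
  obtains S \<alpha> w where "finite S" "\<And>x. x \<in> S \<Longrightarrow> 0 \<le> \<alpha> x" "0 \<le> w"
    "\<And>k. k \<le> 2 * D \<Longrightarrow> s k = (\<Sum>x\<in>S. \<alpha> x * x ^ k) + (if k = 2 * D then w else 0)"
proof -
  obtain p where p: "lead_coeff p = 1" "degree p \<le> D"
    and orth: "\<And>q. degree p + degree q < 2 * D \<Longrightarrow> riesz s (p * q) = 0"
    and pos_def: "\<And>f. f \<noteq> 0 \<Longrightarrow> degree f < degree p \<Longrightarrow> 0 < riesz s (f * f)"
    using exists_orthogonal_polynomial[OF pos] by blast
  define S where "S = {x. poly p x = 0}"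
  have "p \<noteq> 0" using p(1) by auto
  then have fin: "finite S" unfolding S_def by (rule poly_roots_finite)
  have p_eq: "p = (\<Prod>x\<in>S. [:- x, 1:])"
    unfolding S_def using p orth pos_def by (intro orthogonal_polynomial_split) auto
  then have card: "card S = degree p" using degree_prod_roots[OF fin] by simp
  define \<alpha> where "\<alpha> x = riesz s (lagrange_basis S x)" for x
  have quadrature: "riesz s f = (\<Sum>x\<in>S. \<alpha> x * poly f x)" if f: "degree f < 2 * D" for f
  proof -
    let ?I = "\<Sum>x\<in>S. smult (poly f x) (lagrange_basis S x)"
    obtain q where q: "f - ?I = p * q"
      using lagrange_remainder_dvd[OF fin, of f] p_eq by auto
    have "degree ?I < 2 * D"
      using degree_lagrange_sum[OF fin, of "poly f"] card p(2) assms(1) by (cases "S = {}") auto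
    then have "degree (p * q) < 2 * D" using f by (simp flip: q add: degree_diff_less)
    then have "degree p + degree q < 2 * D"
      using \<open>p \<noteq> 0\<close> p(2) assms(1) by (cases "q = 0") (auto simp: degree_mult_eq)
    then have "riesz s (f - ?I) = 0" unfolding q by (rule orth)
    then show ?thesis by (simp add: riesz_diff riesz_lagrange_sum \<alpha>_def)
  qed
  have nonneg: "0 \<le> \<alpha> x" if "x \<in> S" for x
  proof -
    let ?L = "lagrange_basis S x"
    have L: "degree ?L < degree p" using degree_lagrange_basis[OF fin that] card by simp
    then have "degree (?L * ?L) < 2 * D"
      using degree_mult_le[of ?L ?L] p(2) by linarith
    then have "riesz s (?L * ?L) = (\<Sum>y\<in>S. \<alpha> y * poly (?L * ?L) y)" by (rule quadrature)
    also have "\<dots> = (\<Sum>y\<in>S. if y = x then \<alpha> y else 0)"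
      by (intro sum.cong) (auto simp: poly_lagrange_basis[OF fin])
    also have "\<dots> = \<alpha> x" using that fin by simp
    finally show ?thesis using pos[of ?L] L p(2) by simp
  qed
  define w where "w = s (2 * D) - (\<Sum>x\<in>S. \<alpha> x * x ^ (2 * D))"
  have "0 \<le> w"
  proof -
    define g where "g = monom 1 (D - degree p) * p"
    have deg_g: "degree g = D"
      using p(2) \<open>p \<noteq> 0\<close> by (simp add: g_def degree_mult_eq degree_monom_eq)
    have "lead_coeff g = 1"
      unfolding g_def lead_coeff_mult p(1) by (simp add: degree_monom_eq)
    note g = deg_g this
    \<comment> \<open>The leading terms of \<open>g * g\<close> and \<open>X ^ (2 * D)\<close> cancel, so the quadrature applies to the
      difference; moreover \<open>g\<close> vanishes at all nodes.\<close>
    define f where "f = g * g - monom 1 (2 * D)"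
    have gg: "degree (g * g) = 2 * D"
      using g by (subst degree_mult_eq) auto
    have "coeff (g * g) (2 * D) = 1" 
      using lead_coeff_mult[of g g] gg g(2) by simp
    then have "\<forall>k\<ge>2 * D. coeff f k = 0"
      using gg by (auto simp: f_def coeff_eq_0)
    then have "degree f < 2 * D"
      using degree_less_if_coeffs_0[of f "2 * D"] assms(1) by (cases "f = 0") auto
    then have "riesz s f = (\<Sum>x\<in>S. \<alpha> x * poly f x)" by (rule quadrature)
    also have "\<dots> = - (\<Sum>x\<in>S. \<alpha> x * x ^ (2 * D))"
      by (simp add: f_def g_def S_def poly_monom sum_negf)
    finally have "riesz s (g * g) = w"
      by (simp add: f_def riesz_diff riesz_monom w_def)
    then show ?thesis using pos[of g] g by simp
  qed
  have repr: "s k = (\<Sum>x\<in>S. \<alpha> x * x ^ k) + (if k = 2 * D then w else 0)" if "k \<le> 2 * D" for k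
  proof (cases "k = 2 * D")
    case True
    then show ?thesis by (simp add: w_def)
  next
    case False
    then have "riesz s (monom 1 k) = (\<Sum>x\<in>S. \<alpha> x * poly (monom 1 k) x)"
      using that by (intro quadrature) (simp add: degree_monom_eq)
    then show ?thesis using False by (simp add: riesz_monom poly_monom)
  qed
  show ?thesis by (rule that[OF fin nonneg \<open>0 \<le> w\<close> repr])
qed

section \<open>Tensor powers and Hankel tensors\<close>

lemma sum_list_eq_max_iff:
  fixes xs :: "nat list"
  assumes "\<forall>i\<in>set xs. i \<le> b"
  shows "sum_list xs \<le> b * length xs \<and> (sum_list xs = b * length xs \<longleftrightarrow> (\<forall>i\<in>set xs. i = b))"
  using assms
proof (induction xs)
  case (Cons x xs)
  then have "sum_list xs \<le> b * length xs" "x \<le> b"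
    "sum_list xs = b * length xs \<longleftrightarrow> (\<forall>i\<in>set xs. i = b)" by auto
  then show ?case by auto
qed simp

lemma multi_indices_sum_list:
  assumes "is \<in> multi_indices m n"
  shows "sum_list is \<le> (n - 1) * m"
    and "sum_list is = (n - 1) * m \<longleftrightarrow> (\<forall>i\<in>set is. i = n - 1)"
  using assms sum_list_eq_max_iff[of "is" "n - 1"] by (force simp: multi_indices_def)+

lemma tensor_power_vandermonde:
  assumes "is \<in> multi_indices m n"
  shows "tensor_power m (c \<cdot>\<^sub>v vandermonde_vec n \<gamma>) is = c ^ m * \<gamma> ^ sum_list is"
proof -
  have "(\<Prod>i\<leftarrow>is. (c \<cdot>\<^sub>v vandermonde_vec n \<gamma>) $ i) = c ^ length is * \<gamma> ^ sum_list is"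
    if "set is \<subseteq> {..<n}" for "is"
    using that by (induction "is") (auto simp: vandermonde_vec_def power_add)
  then show ?thesis using assms
    by (auto simp: tensor_power_def multi_indices_def vandermonde_vec_def)
qed

text \<open>This is the Hankel tensor whose generating vector is zero except in its last entry: the index
  sum \<open>(n - 1) m\<close> is attained only at the multi-index \<open>(n - 1, \<dots>, n - 1)\<close>.\<close>

lemma tensor_power_last_unit_vec:
  assumes "is \<in> multi_indices m n" "0 < n"
  shows "tensor_power m (c \<cdot>\<^sub>v unit_vec n (n - 1)) is = (if sum_list is = (n - 1) * m then c ^ m else 0)"
proof -
  have "(\<Prod>i\<leftarrow>is. (c \<cdot>\<^sub>v unit_vec n (n - 1)) $ i) = (if \<forall>i\<in>set is. i = n - 1 then c ^ length is else 0)"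
    if "set is \<subseteq> {..<n}" for "is"
    using that assms(2) by (induction "is") auto
  moreover have "set is \<subseteq> {..<n}" "length is = m"
    using assms(1) by (auto simp: multi_indices_def)
  ultimately show ?thesis
    using assms(1) multi_indices_sum_list(2)[OF assms(1)] by (auto simp: tensor_power_def)
qed

lemma tensor_power_outside:
  assumes "x \<in> carrier_vec n" "is \<notin> multi_indices m n"
  shows "tensor_power m x is = 0"
  using assms by (auto simp: tensor_power_def)

lemma completely_r_decomposable_hankelI:
  assumes "hankel_tensor_of m n v A"
    and "\<And>j. j < r \<Longrightarrow> x j \<in> carrier_vec n"
    and "\<And>is. is \<in> multi_indices m n \<Longrightarrow> v $ sum_list is = (\<Sum>j<r. tensor_power m (x j) is)"
  shows "completely_r_decomposable m n r A"
  unfolding completely_r_decomposable_def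
proof (intro conjI exI[of _ x])
  show "A = (\<lambda>is. \<Sum>j<r. tensor_power m (x j) is)"
  proof
    fix "is"
    show "A is = (\<Sum>j<r. tensor_power m (x j) is)"
    proof (cases "is \<in> multi_indices m n")
      case True
      then have "A is = v $ sum_list is" using assms(1) by (simp add: hankel_tensor_of_def)
      then show ?thesis using assms(3)[OF True] by simp
    next
      case False
      then have "A is = 0" using assms(1) by (simp add: hankel_tensor_of_def sym_tensors_def)
      moreover have "(\<Sum>j<r. tensor_power m (x j) is) = 0"
        using tensor_power_outside[OF assms(2) False] by (intro sum.neutral) auto
      ultimately show ?thesis by simp
    qed
  qed
  show "A \<in> sym_tensors m n" using assms(1) by (simp add: hankel_tensor_of_def)
  show "\<forall>j<r. x j \<in> carrier_vec n" using assms(2) by blast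
qed

section \<open>Odd order\<close>

text \<open>The nodes \<open>0, \<dots>, (n - 1) m\<close> serve for all generating vectors at once; the signs of the weights
  are absorbed by odd roots.\<close>

lemma hankel_tensor_odd_order_decomposable:
  assumes A: "hankel_tensor_of m n v A" and "odd m"
  shows "completely_r_decomposable m n ((n - 1) * m + 1) A"
proof (rule completely_r_decomposable_hankelI[OF A])
  let ?N = "(n - 1) * m"
  let ?S = "real ` {..<?N + 1}"
  define \<alpha> where "\<alpha> x = riesz (\<lambda>k. v $ k) (lagrange_basis ?S x)" for x
  let ?x = "\<lambda>j. root m (\<alpha> (real j)) \<cdot>\<^sub>v vandermonde_vec n (real j)"
  show "?x j \<in> carrier_vec n" for j
    by (simp add: vandermonde_vec_def)
  fix "is" assume "is": "is \<in> multi_indices m n"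
  have card: "card ?S = ?N + 1" by (simp add: card_image)
  have "v $ sum_list is = (\<Sum>x\<in>?S. \<alpha> x * x ^ sum_list is)"
    unfolding \<alpha>_def using multi_indices_sum_list(1)[OF "is"] card
    by (intro moments_signed_representation) auto
  also have "\<dots> = (\<Sum>j<?N + 1. \<alpha> (real j) * real j ^ sum_list is)"
    by (subst sum.reindex) auto
  also have "\<dots> = (\<Sum>j<?N + 1. tensor_power m (?x j) is)"
    by (simp only: tensor_power_vandermonde[OF "is"] odd_real_root_pow[OF \<open>odd m\<close>])
  finally show "v $ sum_list is = (\<Sum>j<?N + 1. tensor_power m (?x j) is)" .
qed

section \<open>Even order\<close>

lemma pos_semidef_hankel_imp_riesz_square_nonneg:
  assumes H: "associated_hankel_matrix m n v H" "pos_semidef H"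
    and N: "(n - 1) * m = 2 * D" and f: "degree f \<le> D"
  shows "0 \<le> riesz (\<lambda>k. v $ k) (f * f)"
proof -
  have "real (2 * D + 2) / 2 = real (D + 1)" by simp
  then have size: "nat \<lceil>real (2 * D + 2) / 2\<rceil> = D + 1" by (simp only: ceiling_of_nat nat_int)
  obtain c where "H = mat (D + 1) (D + 1) (\<lambda>(i, j). if i + j \<le> 2 * D then v $ (i + j) else c)"
    using H(1) unfolding associated_hankel_matrix_def Let_def N size by blast
  \<comment> \<open>Index sums are at most \<open>2 * D\<close> for a matrix of size \<open>D + 1\<close>, so the free entry does not occur.\<close>
  then have H_eq: "H = mat (D + 1) (D + 1) (\<lambda>(i, j). v $ (i + j))"
    by (auto intro!: eq_matI)
  define x where "x = vec (D + 1) (coeff f)"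
  have "0 \<le> x \<bullet> (H *\<^sub>v x)"
    using H(2) by (auto simp: pos_semidef_def H_eq x_def)
  also have "x \<bullet> (H *\<^sub>v x) = (\<Sum>i\<in>{0..<D + 1}. coeff f i * (\<Sum>j\<in>{0..<D + 1}. v $ (i + j) * coeff f j))"
    unfolding H_eq x_def by (simp add: scalar_prod_def)
  also have "\<dots> = riesz (\<lambda>k. v $ k) (f * f)"
  proof -
    have "{0..<D + 1} = {..D}" by auto
    then show ?thesis
      by (simp only: riesz_square[OF f] sum_distrib_left) (simp only: ac_simps)
  qed
  finally show ?thesis .
qed

lemma strong_hankel_even_order_moments:
  assumes "2 \<le> m" "2 \<le> n" "even m" "strong_hankel_tensor m n A"
  obtains v r \<alpha> w \<gamma> where "hankel_tensor_of m n v A" "\<forall>j<r. 0 \<le> \<alpha> j" "0 \<le> w"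
    "\<forall>is\<in>multi_indices m n. v $ sum_list is
       = (\<Sum>j<(r::nat). \<alpha> j * \<gamma> j ^ sum_list is) + (if sum_list is = (n - 1) * m then w else 0)"
proof -
  obtain v H where v: "hankel_tensor_of m n v A"
    and H: "associated_hankel_matrix m n v H" "pos_semidef H"
    using assms(4) by (auto simp: strong_hankel_tensor_def)
  obtain D where D: "(n - 1) * m = 2 * D"
    using \<open>even m\<close> by (metis dvd_mult evenE)
  have "0 < D" using D assms(1,2) by (cases D) auto
  obtain S \<alpha> w where S: "finite S" "\<And>x. x \<in> S \<Longrightarrow> 0 \<le> \<alpha> x" and w: "0 \<le> w"
    and repr: "\<And>k. k \<le> 2 * D \<Longrightarrow>
      v $ k = (\<Sum>x\<in>S. \<alpha> x * x ^ k) + (if k = 2 * D then w else 0)"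
    using truncated_hamburger_moments[OF \<open>0 < D\<close>, where s = "\<lambda>k. v $ k"]
      pos_semidef_hankel_imp_riesz_square_nonneg[OF H D] by blast
  obtain \<gamma> where \<gamma>: "bij_betw \<gamma> {..<card S} S"
    using ex_bij_betw_nat_finite[OF S(1)] by (auto simp: atLeast0LessThan)
  show ?thesis
  proof (rule that[OF v _ w])
    show "\<forall>j<card S. 0 \<le> (\<alpha> \<circ> \<gamma>) j"
      using S(2) bij_betwE[OF \<gamma>] by auto
    show "\<forall>is\<in>multi_indices m n. v $ sum_list is = (\<Sum>j<card S. (\<alpha> \<circ> \<gamma>) j * \<gamma> j ^ sum_list is)
        + (if sum_list is = (n - 1) * m then w else 0)"
    proof
      fix "is" assume "is": "is \<in> multi_indices m n"
      show "v $ sum_list is = (\<Sum>j<card S. (\<alpha> \<circ> \<gamma>) j * \<gamma> j ^ sum_list is)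
          + (if sum_list is = (n - 1) * m then w else 0)"
        using repr[of "sum_list is"] multi_indices_sum_list(1)[OF "is", unfolded D]
          sum.reindex_bij_betw[OF \<gamma>, of "\<lambda>x. \<alpha> x * x ^ sum_list is"]
        by (simp only: D comp_apply)
    qed
  qed
qed

lemma strong_hankel_even_order_decomposable:
  assumes "2 \<le> m" "2 \<le> n" "even m" "strong_hankel_tensor m n A"
  shows "completely_decomposable m n A"
proof -
  obtain v r \<alpha> w \<gamma> where A: "hankel_tensor_of m n v A"
    and pos: "\<forall>j<(r::nat). 0 \<le> \<alpha> j" "0 \<le> w"
    and repr: "\<forall>is\<in>multi_indices m n. v $ sum_list is
       = (\<Sum>j<r. \<alpha> j * \<gamma> j ^ sum_list is) + (if sum_list is = (n - 1) * m then w else 0)"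
    by (rule strong_hankel_even_order_moments[OF assms])
  define x where "x j = (if j < r then root m (\<alpha> j) \<cdot>\<^sub>v vandermonde_vec n (\<gamma> j)
    else root m w \<cdot>\<^sub>v unit_vec n (n - 1))" for j
  have "completely_r_decomposable m n (Suc r) A"
  proof (rule completely_r_decomposable_hankelI[OF A])
    show "x j \<in> carrier_vec n" for j by (auto simp: x_def vandermonde_vec_def)
    fix "is" assume "is": "is \<in> multi_indices m n"
    have root: "root m a ^ m = a" if "0 \<le> a" for a
      using that assms(1) by (intro real_root_pow_pos2) auto
    have "tensor_power m (x j) is = \<alpha> j * \<gamma> j ^ sum_list is" if "j < r" for j
      using that pos(1) by (simp add: x_def tensor_power_vandermonde[OF "is"] root)
    moreover have "tensor_power m (x r) is = (if sum_list is = (n - 1) * m then w else 0)"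
    proof -
      have "0 < n" using assms(2) by simp
      from tensor_power_last_unit_vec[OF "is" this, of "root m w"]
      show ?thesis unfolding x_def root[OF pos(2)] by simp
    qed
    ultimately show "v $ sum_list is = (\<Sum>j<Suc r. tensor_power m (x j) is)"
      by (simp add: bspec[OF repr "is"])
  qed
  then show ?thesis unfolding completely_decomposable_def by blast
qed

lemma LIMSEQ_fun_iff:
  fixes X :: "nat \<Rightarrow> 'a \<Rightarrow> 'b::topological_space"
  shows "X \<longlonglongrightarrow> L \<longleftrightarrow> (\<forall>i. (\<lambda>k. X k i) \<longlonglongrightarrow> L i)"
  using limitin_componentwise[of "\<lambda>_. euclidean" UNIV X L sequentially]
  by (simp add: euclidean_product_topology)

text \<open>A node escaping to infinity with weight \<open>w / t\<^sup>N\<close> contributes in the limit to the moment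
  of order \<open>N\<close> only.\<close>

lemma scaled_power_tendsto_top_moment:
  assumes "k \<le> N"
  shows "(\<lambda>t. w / real (Suc t) ^ N * real (Suc t) ^ k) \<longlonglongrightarrow> (if k = N then w else 0)"
proof (cases "k = N")
  case False
  obtain d where d: "N = k + d" using assms by (metis le_Suc_ex)
  have "w / real (Suc t) ^ N * real (Suc t) ^ k = w * (1 / real (Suc t)) ^ d" for t
    by (simp add: d power_add power_one_over del: of_nat_Suc)
  moreover have "(\<lambda>t. w * (1 / real (Suc t)) ^ d) \<longlonglongrightarrow> w * 0 ^ d"
    by (intro tendsto_intros LIMSEQ_Suc[OF lim_1_over_n])
  moreover have "0 < d" using False d by simp
  ultimately show ?thesis using False by (simp add: zero_power)
qed simp

lemma strong_hankel_even_order_limit: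
  assumes "2 \<le> m" "2 \<le> n" "even m" "strong_hankel_tensor m n A"
  shows "\<exists>X. (\<forall>t. complete_hankel_tensor m n (X t)) \<and> X \<longlonglongrightarrow> A"
proof -
  obtain v r \<alpha> w \<gamma> where A: "hankel_tensor_of m n v A"
    and pos: "\<forall>j<(r::nat). 0 \<le> \<alpha> j" "0 \<le> w"
    and repr: "\<forall>is\<in>multi_indices m n. v $ sum_list is
       = (\<Sum>j<r. \<alpha> j * \<gamma> j ^ sum_list is) + (if sum_list is = (n - 1) * m then w else 0)"
    by (rule strong_hankel_even_order_moments[OF assms])
  let ?N = "(n - 1) * m"
  define \<beta> where "\<beta> t j = (if j < r then \<alpha> j else w / real (Suc t) ^ ?N)" for t j
  define \<delta> where "\<delta> t j = (if j < r then \<gamma> j else real (Suc t))" for t j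
  define X where "X t = (\<lambda>is. \<Sum>j<Suc r. \<beta> t j * tensor_power m (vandermonde_vec n (\<delta> t j)) is)" for t
  have "complete_hankel_tensor m n (X t)" for t
    unfolding complete_hankel_tensor_def X_def
    by (rule exI[of _ "Suc r"], rule exI[of _ "\<beta> t"], rule exI[of _ "\<delta> t"])
      (use pos in \<open>auto simp: \<beta>_def\<close>)
  moreover have "(\<lambda>t. X t is) \<longlonglongrightarrow> A is" for "is"
  proof (cases "is \<in> multi_indices m n")
    case True
    have "tensor_power m (vandermonde_vec n g) is = g ^ sum_list is" for g
      using tensor_power_vandermonde[OF True, of 1 g] by simp
    then have X_is: "X t is = (\<Sum>j<r. \<alpha> j * \<gamma> j ^ sum_list is)
        + w / real (Suc t) ^ ?N * real (Suc t) ^ sum_list is" for t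
      by (simp add: X_def \<beta>_def \<delta>_def)
    have A_is: "A is = (\<Sum>j<r. \<alpha> j * \<gamma> j ^ sum_list is) + (if sum_list is = ?N then w else 0)"
      using A True bspec[OF repr True] by (simp add: hankel_tensor_of_def)
    show ?thesis
      unfolding X_is A_is
      by (intro tendsto_add tendsto_const scaled_power_tendsto_top_moment
          multi_indices_sum_list(1)[OF True])
  next
    case False
    then have "A is = 0" using A by (simp add: hankel_tensor_of_def sym_tensors_def)
    moreover have "X t is = 0" for t
      using False by (simp add: X_def tensor_power_outside[where n = n] vandermonde_vec_def)
    ultimately show ?thesis by simp
  qed
  ultimately show ?thesis by (auto simp: LIMSEQ_fun_iff)
qed

section \<open>Strong Hankel tensors\<close>

theorem theorem2:
  fixes m n :: nat and A :: "nat list \<Rightarrow> real"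
  assumes "m \<ge> 2" and "n \<ge> 2"
    and "strong_hankel_tensor m n A"
  shows "(even m \<longrightarrow> completely_decomposable m n A \<and>
            (\<exists>X :: nat \<Rightarrow> nat list \<Rightarrow> real.
               (\<forall>k. complete_hankel_tensor m n (X k)) \<and> X \<longlonglongrightarrow> A)) \<and>
         (odd m \<longrightarrow> completely_r_decomposable m n ((n - 1) * m + 1) A)"
proof (intro conjI impI)
  assume "even m"
  then show "completely_decomposable m n A"
    and "\<exists>X. (\<forall>k. complete_hankel_tensor m n (X k)) \<and> X \<longlonglongrightarrow> A"
    using assms strong_hankel_even_order_decomposable strong_hankel_even_order_limit by simp_all
next
  assume "odd m"
  then show "completely_r_decomposable m n ((n - 1) * m + 1) A"
    using assms(3) hankel_tensor_odd_order_decomposable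
    unfolding strong_hankel_tensor_def by blast
qed

end
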